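(* Let $z\in\mathbb{C}_p$. Suppose that for $k\in\mathbb{Z}_{\geq 1}$ there exists $f_k(x,y)\in\mathbb{Q}(y)[x]$ such that the map defined on compact open subsets of $\mathbb{Z}_p$ of the form $a+(p^N)$, $0\leq a\leq p^N-1$, by $$\mu_{k,z}(a+(p^N)) = p^{N(k-1)}\, z^a\, f_k(a/p^N, z^{p^N})$$ extends to a $p$-adic distribution on $\mathbb{Z}_p$, and suppose that $f_k(x,y)$ and the partial derivatives of $f_k(x,y)$ with respect to $x$ are defined at $(0,0)$. Let $h(k)\in\mathbb{Q}$ be the constant, depending only on $k$, with $y f_k(x+1,y)-f_k(x,y)=h(k)\,x^{k-1}$. Then $f_k(x,y)$, and so $\mu_{k,z}$, is uniquely determined by the choice of $h(k)$.
   Context: $p$ is a prime. $\mathbb{C}_p$ is the completion of a fixed algebraic closure of $\mathbb{Q}_p$. $(p^N)=p^N\mathbb{Z}_p$. A $p$-adic distribution on $\mathbb{Z}_p$ is a finitely additive $\mathbb{C}_p$-valued function on the compact open subsets of $\mathbb{Z}_p$. The existence of the constant $h(k)$ under the stated hypotheses is a preceding result of the paper. *)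

theory Defs
  imports
    "HOL-Analysis.Analysis"
    "HOL-Computational_Algebra.Computational_Algebra"
    "HOL-Computational_Algebra.Field_as_Ring"
begin

section \<open>The field of p-adic complex numbers\<close>

definition padic_abs :: "nat \<Rightarrow> rat \<Rightarrow> real" where
  "padic_abs p r =
     (if r = 0 then 0
      else real p powi (int (multiplicity (int p) (snd (quotient_of r)))
                      - int (multiplicity (int p) (fst (quotient_of r)))))"

locale nonarch_abs =
  fixes v :: "'a::field \<Rightarrow> real"
  assumes v_nonneg: "0 \<le> v x"
    and v_eq_0_iff: "v x = 0 \<longleftrightarrow> x = 0"
    and v_mult: "v (x * y) = v x * v y"
    and v_add: "v (x + y) \<le> max (v x) (v y)"

definition vdist :: "('a::field \<Rightarrow> real) \<Rightarrow> 'a \<Rightarrow> 'a \<Rightarrow> real" where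
  "vdist v x y = v (x - y)"

lemma (in nonarch_abs) Metric_space_vdist: "Metric_space M (vdist v)"
proof -
  have one: "v 1 = 1"
    using v_mult[of 1 1] v_eq_0_iff[of 1] by simp
  have "v (- 1) * v (- 1) = 1"
    using v_mult[of "- 1" "- 1"] one by simp
  then have "v (- 1) = 1"
    using v_nonneg[of "- 1"] by (simp add: square_eq_1_iff)
  then have minus: "v (- x) = v x" for x
    using v_mult[of "- 1" x] by simp
  show ?thesis
  proof
    show "0 \<le> vdist v x y" for x y
      by (simp add: vdist_def v_nonneg)
    show "vdist v x y = vdist v y x" for x y
      using minus[of "x - y"] by (simp add: vdist_def)
    show "(vdist v x y = 0) = (x = y)" for x y
      by (simp add: vdist_def v_eq_0_iff)
    show "vdist v x z \<le> vdist v x y + vdist v y z" for x y z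
      using v_add[of "x - y" "y - z"] v_nonneg[of "x - y"] v_nonneg[of "y - z"]
      by (simp add: vdist_def)
  qed
qed

definition is_completion :: "('a::field \<Rightarrow> real) \<Rightarrow> 'a set \<Rightarrow> 'a set \<Rightarrow> bool" where
  "is_completion v A B \<longleftrightarrow>
     A \<subseteq> B \<and> Metric_space.mcomplete B (vdist v) \<and>
     Metric_space.mtopology B (vdist v) closure_of A = B"

definition is_subfield :: "'a::field set \<Rightarrow> bool" where
  "is_subfield F \<longleftrightarrow>
     0 \<in> F \<and> 1 \<in> F \<and>
     (\<forall>x\<in>F. \<forall>y\<in>F. x - y \<in> F \<and> x * y \<in> F) \<and> (\<forall>x\<in>F. inverse x \<in> F)"

definition algebraic_over :: "'a::field set \<Rightarrow> 'a \<Rightarrow> bool" where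
  "algebraic_over F x \<longleftrightarrow> (\<exists>q. q \<noteq> 0 \<and> (\<forall>i. coeff q i \<in> F) \<and> poly q x = 0)"

definition is_algebraic_closure :: "'a::field set \<Rightarrow> 'a set \<Rightarrow> bool" where
  "is_algebraic_closure F A \<longleftrightarrow>
     F \<subseteq> A \<and> is_subfield F \<and> is_subfield A \<and> (\<forall>x\<in>A. algebraic_over F x) \<and>
     (\<forall>q. degree q > 0 \<and> (\<forall>i. coeff q i \<in> A) \<longrightarrow> (\<exists>x\<in>A. poly q x = 0))"

text \<open>
  The whole type \<open>'a\<close> with the absolute value \<open>v\<close> is the completion of an algebraic closure
  \<open>Qpbar\<close> of \<open>Qp\<close>, where \<open>Qp\<close> is the completion of the rationals with respect to the
  p-adic absolute value. These data determine \<open>('a, v)\<close> up to isometric isomorphism;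
  the libraries used here contain no construction of such a field, so the intermediate
  fields are parameters.
\<close>

locale padic_complex = nonarch_abs v
  for v :: "'a::field_char_0 \<Rightarrow> real" +
  fixes p :: nat and Qp Qpbar :: "'a set"
  assumes prime_p: "prime p"
    and v_of_rat: "v (of_rat r) = padic_abs p r"
    and Qp_completion: "is_completion v (range of_rat) Qp"
    and Qpbar_closure: "is_algebraic_closure Qp Qpbar"
    and Cp_completion: "is_completion v Qpbar UNIV"


section \<open>Distributions on the p-adic integers\<close>

definition Zp :: "('a::field \<Rightarrow> real) \<Rightarrow> 'a set \<Rightarrow> 'a set" where
  "Zp v Qp = {x \<in> Qp. v x \<le> 1}"

definition Zp_topology :: "('a::field \<Rightarrow> real) \<Rightarrow> 'a set \<Rightarrow> 'a topology" where
  "Zp_topology v Qp = Metric_space.mtopology (Zp v Qp) (vdist v)"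

definition compact_open :: "('a::field \<Rightarrow> real) \<Rightarrow> 'a set \<Rightarrow> 'a set \<Rightarrow> bool" where
  "compact_open v Qp U \<longleftrightarrow> compactin (Zp_topology v Qp) U \<and> openin (Zp_topology v Qp) U"

text \<open>Only the values of \<open>\<mu>\<close> on compact open sets are meaningful.\<close>

definition padic_distribution ::
    "('a::field \<Rightarrow> real) \<Rightarrow> 'a set \<Rightarrow> ('a set \<Rightarrow> 'a) \<Rightarrow> bool" where
  "padic_distribution v Qp \<mu> \<longleftrightarrow>
     (\<forall>U V. compact_open v Qp U \<and> compact_open v Qp V \<and> U \<inter> V = {} \<longrightarrow>
        \<mu> (U \<union> V) = \<mu> U + \<mu> V)"

definition coset_Zp :: "nat \<Rightarrow> ('a::field \<Rightarrow> real) \<Rightarrow> 'a set \<Rightarrow> nat \<Rightarrow> nat \<Rightarrow> 'a set" where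
  "coset_Zp p v Qp a N = {of_nat a + of_nat p ^ N * u | u. u \<in> Zp v Qp}"


section \<open>Polynomials in x over the rational functions in y\<close>

type_synonym ratfun = "rat poly fract"

definition ratfun_const :: "rat \<Rightarrow> ratfun" where
  "ratfun_const c = Fract [:c:] 1"

definition ratfun_Y :: ratfun where
  "ratfun_Y = Fract [:0, 1:] 1"

text \<open>
  \<open>quot_of_fract\<close> is the representation in lowest terms, so \<open>ratfun_defined\<close> says that
  there is no pole at \<open>w\<close>; \<open>ratfun_eval\<close> is meaningful only in that case.
\<close>

definition ratfun_defined :: "ratfun \<Rightarrow> 'a::field_char_0 \<Rightarrow> bool" where
  "ratfun_defined c w \<longleftrightarrow> poly (map_poly of_rat (snd (quot_of_fract c))) w \<noteq> 0"

definition ratfun_eval :: "ratfun \<Rightarrow> 'a::field_char_0 \<Rightarrow> 'a" where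
  "ratfun_eval c w =
     poly (map_poly of_rat (fst (quot_of_fract c))) w /
     poly (map_poly of_rat (snd (quot_of_fract c))) w"

text \<open>
  The reduced denominator of an element of \<open>\<rat>(y)[x]\<close>, viewed as a rational function in
  \<open>x\<close> and \<open>y\<close>, is the least common denominator of its coefficients and involves \<open>y\<close> only.
  Hence being defined at \<open>(x\<^sub>0, w)\<close> does not depend on \<open>x\<^sub>0\<close>.
\<close>

definition defined_at :: "ratfun poly \<Rightarrow> 'a::field_char_0 \<Rightarrow> bool" where
  "defined_at f w \<longleftrightarrow> (\<forall>i. ratfun_defined (coeff f i) w)"

definition eval2 :: "ratfun poly \<Rightarrow> 'a::field_char_0 \<Rightarrow> 'a \<Rightarrow> 'a" where
  "eval2 f x w = (\<Sum>i\<le>degree f. ratfun_eval (coeff f i) w * x ^ i)"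

definition extends_mu ::
    "nat \<Rightarrow> ('a::field_char_0 \<Rightarrow> real) \<Rightarrow> 'a set \<Rightarrow> nat \<Rightarrow> 'a \<Rightarrow> ratfun poly \<Rightarrow> ('a set \<Rightarrow> 'a) \<Rightarrow> bool" where
  "extends_mu p v Qp k z f \<mu> \<longleftrightarrow>
     padic_distribution v Qp \<mu> \<and>
     (\<forall>N a. a < p ^ N \<longrightarrow>
        defined_at f (z ^ (p ^ N)) \<and>
        \<mu> (coset_Zp p v Qp a N) =
          of_nat p ^ (N * (k - 1)) * z ^ a * eval2 f (of_nat a / of_nat p ^ N) (z ^ (p ^ N)))"

definition derivs_defined_at_origin :: "ratfun poly \<Rightarrow> bool" where
  "derivs_defined_at_origin f \<longleftrightarrow> (\<forall>j. defined_at ((pderiv ^^ j) f) (0::rat))"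

definition shift_equation :: "nat \<Rightarrow> rat \<Rightarrow> ratfun poly \<Rightarrow> bool" where
  "shift_equation k h f \<longleftrightarrow>
     smult ratfun_Y (pcompose f [:1, 1:]) - f = monom (ratfun_const h) (k - 1)"

end

theory Submission
  imports Defs
begin

text \<open>
  The difference \<open>d\<close> of two solutions of the functional equation satisfies the homogeneous
  equation \<open>y d(x + 1, y) = d(x, y)\<close>. Translating \<open>x\<close> leaves the leading coefficient in \<open>x\<close>
  alone, so this coefficient is fixed under multiplication by \<open>y\<close>. In the field \<open>\<rat>(y)\<close> that
  forces it to be \<open>0\<close>, because \<open>y \<noteq> 1\<close>. Hence \<open>d = 0\<close>: the constant \<open>h(k)\<close> determines
  \<open>f\<^sub>k\<close> (\<open>shift_equation_unique\<close>).

  Once \<open>f\<^sub>k\<close> is known, so are the values of the distribution on the cosets \<open>a + (p\<^sup>N)\<close>.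
  These determine it on every compact open set \<open>U\<close>
  (\<open>distribution_determined_by_cosets\<close>): by compactness a single radius \<open>p\<^sup>-\<^sup>N\<close> works
  for all points of \<open>U\<close>, so \<open>U\<close> is a union of balls of that radius; since the integers are dense
  in \<open>\<int>\<^sub>p\<close>, each ball is the coset of some \<open>a < p\<^sup>N\<close>. Thus \<open>U\<close> is a finite disjoint
  union of cosets (\<open>compact_open_decomposition\<close>), and finite additivity gives the value.
  Additivity applies because each of these cosets is compact open: it is both open and closed in
  \<open>\<int>\<^sub>p\<close>, and a closed subset of \<open>U\<close> inherits compactness from \<open>U\<close>.
\<close>

section \<open>The functional equation\<close>

text \<open>
  Substituting \<open>x + 1\<close> for \<open>x\<close> preserves the leading coefficient, so the leading
  coefficient \<open>a\<close> of \<open>d\<close> satisfies \<open>(c - 1) a = 0\<close>.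
\<close>

lemma poly_eq_0_if_smult_shift_eq:
  fixes d :: "'b::idom poly"
  assumes "smult c (pcompose d [:1, 1:]) = d" and "c \<noteq> 1"
  shows "d = 0"
proof -
  have "lead_coeff (pcompose d [:1, 1:]) = lead_coeff d"
    by (simp add: lead_coeff_comp)
  then have "c * lead_coeff d = lead_coeff d"
    using assms(1) by (metis lead_coeff_smult)
  then show ?thesis
    using assms(2) by simp
qed

lemma ratfun_Y_neq_1: "ratfun_Y \<noteq> 1"
  by (simp add: ratfun_Y_def One_fract_def eq_fract one_pCons)

lemma shift_equation_unique:
  assumes "shift_equation k h f" and "shift_equation k h g"
  shows "f = g"
proof -
  have "smult ratfun_Y (pcompose (f - g) [:1, 1:]) = f - g"
    using assms by (simp add: shift_equation_def pcompose_diff smult_diff_right algebra_simps)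
  then show ?thesis
    using poly_eq_0_if_smult_shift_eq[OF _ ratfun_Y_neq_1] by fastforce
qed

section \<open>Non-archimedean absolute values\<close>

context nonarch_abs
begin

lemma v_0 [simp]: "v 0 = 0"
  by (simp add: v_eq_0_iff)

lemma v_1 [simp]: "v 1 = 1"
  using v_mult[of 1 1] v_eq_0_iff[of 1] by simp

lemma v_commute: "v (x - y) = v (y - x)"
  using Metric_space.commute[OF Metric_space_vdist] unfolding vdist_def .

lemma v_minus [simp]: "v (- x) = v x"
  using v_commute[of 0 x] by simp

lemma v_power: "v (x ^ n) = v x ^ n"
  by (induction n) (simp_all add: v_mult)

lemma v_divide: "v (x / y) = v x / v y"
proof (cases "y = 0")
  case False
  then show ?thesis
    using v_mult[of "x / y" y] v_eq_0_iff[of y] by (simp add: field_simps)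
qed simp

lemma v_of_nat_le_1: "v (of_nat n) \<le> 1"
proof (induction n)
  case (Suc n)
  then show ?case using v_add[of 1 "of_nat n"] by simp
qed simp

lemma v_of_int_le_1: "v (of_int i) \<le> 1"
  by (cases i rule: int_cases2) (simp_all add: v_of_nat_le_1)

lemma v_ultrametric:
  assumes "v (x - y) \<le> r" and "v (y - z) \<le> r"
  shows "v (x - z) \<le> r"
  using v_add[of "x - y" "y - z"] assms by simp

end

section \<open>Cosets as balls\<close>

context padic_complex
begin

lemma one_less_p: "1 < p"
  using prime_p by (rule prime_gt_1_nat)

lemma v_of_int_eq_power:
  assumes "i \<noteq> 0"
  shows "v (of_int i) = (1 / real p) ^ multiplicity (int p) i"
proof -
  have "v (of_int i) = padic_abs p (of_int i)"
    using v_of_rat[of "of_int i"] by simp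
  then show ?thesis
    using assms one_less_p by (simp add: padic_abs_def power_int_minus field_simps)
qed

text \<open>
  The bridge between analysis and arithmetic: distances between integers are congruences modulo
  powers of \<open>p\<close>.
\<close>

lemma v_of_int_le_iff_dvd: "v (of_int i) \<le> (1 / real p) ^ N \<longleftrightarrow> int p ^ N dvd i"
proof (cases "i = 0")
  case False
  have "\<not> is_unit (int p)"
    using one_less_p by simp
  then show ?thesis
    using False one_less_p
    by (simp add: v_of_int_eq_power power_dvd_iff_le_multiplicity power_decreasing_iff)
qed simp

lemma v_p: "v (of_nat p) = 1 / real p"
  using v_of_int_eq_power[of "int p"] one_less_p by (simp add: multiplicity_self)

lemma subfield_Qp: "is_subfield Qp"
  using Qpbar_closure by (simp add: is_algebraic_closure_def)

lemma Qp_diff: "x \<in> Qp \<Longrightarrow> y \<in> Qp \<Longrightarrow> x - y \<in> Qp"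
  and Qp_mult: "x \<in> Qp \<Longrightarrow> y \<in> Qp \<Longrightarrow> x * y \<in> Qp"
  and Qp_inverse: "x \<in> Qp \<Longrightarrow> inverse x \<in> Qp"
  using subfield_Qp by (auto simp: is_subfield_def)

lemma Qp_of_rat: "of_rat r \<in> Qp"
  using Qp_completion by (auto simp: is_completion_def)

lemma Qp_of_nat: "of_nat n \<in> Qp"
  using Qp_of_rat[of "of_nat n"] by simp

lemma Qp_add: "x \<in> Qp \<Longrightarrow> y \<in> Qp \<Longrightarrow> x + y \<in> Qp"
  using Qp_diff[of x "0 - y"] Qp_diff[of 0 y] Qp_of_nat[of 0] by simp

lemma of_nat_in_Zp: "of_nat n \<in> Zp v Qp"
  by (simp add: Zp_def Qp_of_nat v_of_nat_le_1)

text \<open>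
  Since \<open>p\<close> has absolute value \<open>1 / p\<close>, an element of \<open>\<rat>\<^sub>p\<close> can be divided by \<open>p\<^sup>N\<close>
  within \<open>\<int>\<^sub>p\<close> exactly when its absolute value is at most \<open>(1 / p)\<^sup>N\<close>. In this
  metric form the cosets become accessible to topological arguments.
\<close>

lemma coset_Zp_eq_ball:
  "coset_Zp p v Qp a N = {y \<in> Zp v Qp. v (y - of_nat a) \<le> (1 / real p) ^ N}"
proof (intro set_eqI iffI)
  fix y assume "y \<in> coset_Zp p v Qp a N"
  then obtain u where u: "u \<in> Qp" "v u \<le> 1" and y: "y = of_nat a + of_nat p ^ N * u"
    by (auto simp: coset_Zp_def Zp_def)
  have Nle: "(1 / real p) ^ N \<le> 1"
    using one_less_p by (intro power_le_one) auto
  have close: "v (y - of_nat a) \<le> (1 / real p) ^ N"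
    using u(2) mult_left_mono[of "v u" 1 "(1 / real p) ^ N"]
    by (simp add: y v_mult v_power v_p)
  then have "v (y - 0) \<le> 1"
    using Nle v_of_nat_le_1 by - (rule v_ultrametric[of y "of_nat a" 1 0], auto)
  moreover have "y \<in> Qp"
    unfolding y of_nat_power[symmetric] by (intro Qp_add Qp_mult Qp_of_nat u)
  ultimately show "y \<in> {y \<in> Zp v Qp. v (y - of_nat a) \<le> (1 / real p) ^ N}"
    using close by (simp add: Zp_def)
next
  fix y assume y: "y \<in> {y \<in> Zp v Qp. v (y - of_nat a) \<le> (1 / real p) ^ N}"
  define u where "u = (y - of_nat a) * inverse (of_nat (p ^ N))"
  have p0: "(of_nat p :: 'a) \<noteq> 0" "real p > 0"
    using one_less_p by auto
  have "u \<in> Qp"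
    unfolding u_def using y by (intro Qp_mult Qp_inverse Qp_diff Qp_of_nat) (simp add: Zp_def)
  moreover have "v u \<le> 1"
    using y p0(2) unfolding u_def divide_inverse[symmetric]
    by (simp add: v_divide v_power v_p field_simps)
  moreover have "y = of_nat a + of_nat p ^ N * u"
    using p0(1) by (simp add: u_def field_simps)
  ultimately show "y \<in> coset_Zp p v Qp a N"
    by (auto simp: coset_Zp_def Zp_def)
qed

lemma coset_Zp_disjoint:
  assumes "a < p ^ N" and "b < p ^ N" and "a \<noteq> b"
  shows "coset_Zp p v Qp a N \<inter> coset_Zp p v Qp b N = {}"
proof (rule ccontr)
  assume "\<not> ?thesis"
  then obtain y where "v (of_nat a - y) \<le> (1 / real p) ^ N" "v (y - of_nat b) \<le> (1 / real p) ^ N"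
    by (auto simp: coset_Zp_eq_ball v_commute[of _ "of_nat a"])
  then have "v (of_nat a - of_nat b) \<le> (1 / real p) ^ N"
    by (rule v_ultrametric)
  then have "int (p ^ N) dvd int a - int b"
    using v_of_int_le_iff_dvd[of "int a - int b" N] by simp
  then have "int a mod int (p ^ N) = int b mod int (p ^ N)"
    by (simp add: mod_eq_dvd_iff)
  then have "int a = int b"
    using assms(1,2) by simp
  then show False
    using assms(3) by simp
qed

text \<open>
  In lowest terms \<open>r = m / n\<close> is \<open>p\<close>-integral only if \<open>p\<close> does not divide \<open>n\<close>. Then
  \<open>n\<close> is invertible modulo \<open>p\<^sup>N\<close>, and the residue \<open>a\<close> of \<open>m n\<^sup>-\<^sup>1\<close> approximates \<open>r\<close>:
  the numerator \<open>m - n a\<close> of the difference is divisible by \<open>p\<^sup>N\<close>, and its denominator \<open>n\<close>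
  has absolute value \<open>1\<close>.
\<close>

lemma rational_near_integer:
  assumes "v (of_rat r) \<le> 1"
  obtains a where "a < p ^ N" and "v (of_rat r - of_nat a) \<le> (1 / real p) ^ N"
proof -
  obtain m n where mn: "quotient_of r = (m, n)"
    by fastforce
  have n0: "n > 0" and cop: "coprime m n" and r: "r = of_int m / of_int n"
    using mn quotient_of_denom_pos quotient_of_coprime quotient_of_div by auto
  have vr: "v (of_rat r) = v (of_int m) / v (of_int n)"
    by (simp add: r of_rat_divide v_divide)
  have vn0: "v (of_int n) > 0"
    using n0 v_nonneg[of "of_int n"] v_eq_0_iff[of "of_int n"] by (simp add: less_le)
  have "\<not> int p dvd n"
  proof
    \<comment> \<open>The bound \<open>v r \<le> 1\<close> would pass divisibility by \<open>p\<close> on to the numerator.\<close>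
    assume pn: "int p dvd n"
    have "v (of_int m) \<le> v (of_int n)"
      using assms vn0 by (simp add: vr field_simps)
    also have "\<dots> \<le> (1 / real p) ^ 1"
      using pn by (subst v_of_int_le_iff_dvd) simp
    finally have "int p dvd m"
      using v_of_int_le_iff_dvd[of m 1] by simp
    then have "int p dvd 1"
      using pn cop coprime_common_divisor by blast
    then show False
      using one_less_p by simp
  qed
  then have "coprime (int p) n" and vn: "v (of_int n) = 1"
    using prime_p n0
    by (simp_all add: prime_imp_coprime v_of_int_eq_power not_dvd_imp_multiplicity_0)
  then have cn: "coprime n (int p ^ N)"
    by (simp add: coprime_commute)
  then obtain n' q where bezout: "n' * n + q * int p ^ N = 1"
    using bezout_int[of n "int p ^ N"] by auto
  define a where "a = nat ((m * n') mod int p ^ N)"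
  have pN: "int p ^ N > 0"
    using one_less_p by simp
  have a: "int a = (m * n') mod int p ^ N"
    using pN by (simp add: a_def)
  then have "int a < int (p ^ N)"
    using pN by simp
  then have a_less: "a < p ^ N"
    by linarith
  have "m - n * int a = m * (n' * n + q * int p ^ N) - n * (m * n' - int p ^ N * (m * n' div int p ^ N))"
    unfolding bezout a by (simp add: minus_mult_div_eq_mod)
  also have "\<dots> = int p ^ N * (m * q + n * (m * n' div int p ^ N))"
    by (simp add: algebra_simps)
  finally have "int p ^ N dvd m - n * int a"
    by (rule dvdI)
  then have le: "v (of_int (m - n * int a)) \<le> (1 / real p) ^ N"
    by (simp only: v_of_int_le_iff_dvd)
  have eq: "of_rat r - of_nat a = of_int (m - n * int a) / (of_int n :: 'a)"
    using n0 by (simp add: r of_rat_divide field_simps)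
  have "v (of_rat r - of_nat a) \<le> (1 / real p) ^ N"
    unfolding eq v_divide vn using le by simp
  with a_less show thesis
    by (rule that)
qed

text \<open>
  A point of \<open>\<int>\<^sub>p\<close> is close to a rational number because \<open>\<rat>\<^sub>p\<close> is the completion of
  \<open>\<rat>\<close>; by the ultrametric inequality this rational is itself \<open>p\<close>-integral, hence close to an
  integer in the required range.
\<close>

lemma Zp_covered_by_cosets:
  assumes x: "x \<in> Zp v Qp"
  obtains a where "a < p ^ N" and "x \<in> coset_Zp p v Qp a N"
proof -
  have r0: "(1 / real p) ^ N > 0" and r1: "(1 / real p) ^ N \<le> 1"
    using one_less_p by (auto intro!: power_le_one)
  interpret M: Metric_space Qp "vdist v"
    by (rule Metric_space_vdist)
  have "x \<in> M.mtopology closure_of (range of_rat)"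
    using Qp_completion x by (simp add: is_completion_def Zp_def)
  then obtain r where "vdist v x (of_rat r) < (1 / real p) ^ N"
    using r0 unfolding M.metric_closure_of by (auto simp: M.in_mball)
  then have near: "v (x - of_rat r) \<le> (1 / real p) ^ N"
    by (simp add: vdist_def)
  have "v (of_rat r - 0) \<le> 1"
    using near r1 x by - (rule v_ultrametric[of "of_rat r" x 1 0], auto simp: v_commute[of "of_rat r"] Zp_def)
  then obtain a where "a < p ^ N" "v (of_rat r - of_nat a) \<le> (1 / real p) ^ N"
    using rational_near_integer by auto
  then show thesis
    using that x near v_ultrametric unfolding coset_Zp_eq_ball by blast
qed

section \<open>Decomposition of compact open sets\<close>

sublocale Zp: Metric_space "Zp v Qp" "vdist v"
  by (rule Metric_space_vdist)

lemma open_contains_ball_of_radius_power: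
  assumes "y \<in> Zp v Qp" and "openin (Zp_topology v Qp) U" and "y \<in> U"
  obtains n where "{w \<in> Zp v Qp. v (w - y) \<le> (1 / real p) ^ n} \<subseteq> U"
proof -
  obtain r where r: "r > 0" "Zp.mball y r \<subseteq> U"
    using assms by (auto simp: Zp_topology_def Zp.openin_mtopology)
  obtain n where "(1 / real p) ^ n < r"
    using real_arch_pow_inv[OF r(1), of "1 / real p"] one_less_p by auto
  then have "{w \<in> Zp v Qp. v (w - y) \<le> (1 / real p) ^ n} \<subseteq> Zp.mball y r"
    using assms(1) by (auto simp: Zp.in_mball vdist_def v_commute)
  then show thesis
    using that r(2) by blast
qed

text \<open>
  The form of openness that the ultrametric inequality yields: any point of a ball is a centre of
  it. It serves both for the cosets and for the set of all points whose ball of a fixed radius lies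
  in a given set.
\<close>

lemma openin_Zp_if_uniform_balls:
  assumes "W \<subseteq> Zp v Qp"
    and "\<And>w y. w \<in> W \<Longrightarrow> y \<in> Zp v Qp \<Longrightarrow> v (y - w) \<le> (1 / real p) ^ n \<Longrightarrow> y \<in> W"
  shows "openin (Zp_topology v Qp) W"
  unfolding Zp_topology_def Zp.openin_mtopology
proof (intro conjI allI impI assms(1))
  fix w assume "w \<in> W"
  then have "Zp.mball w ((1 / real p) ^ n) \<subseteq> W"
    using assms(2) by (auto simp: Zp.in_mball vdist_def v_commute)
  moreover have "(1 / real p) ^ n > 0"
    using one_less_p by simp
  ultimately show "\<exists>r>0. Zp.mball w r \<subseteq> W"
    by blast
qed

lemma coset_Zp_open: "openin (Zp_topology v Qp) (coset_Zp p v Qp a N)"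
proof (rule openin_Zp_if_uniform_balls[of _ N])
  fix w y
  assume "w \<in> coset_Zp p v Qp a N" and "y \<in> Zp v Qp" and "v (y - w) \<le> (1 / real p) ^ N"
  then show "y \<in> coset_Zp p v Qp a N"
    using v_ultrametric[of y w "(1 / real p) ^ N" "of_nat a"] by (simp add: coset_Zp_eq_ball)
qed (auto simp: coset_Zp_eq_ball)

lemma coset_Zp_closed: "closedin (Zp_topology v Qp) (coset_Zp p v Qp a N)"
proof -
  have "coset_Zp p v Qp a N = Zp.mcball (of_nat a) ((1 / real p) ^ N)"
    by (auto simp: coset_Zp_eq_ball Zp.in_mcball vdist_def v_commute of_nat_in_Zp)
  then show ?thesis
    by (simp add: Zp_topology_def)
qed

text \<open>
  The points of \<open>U\<close> whose ball of radius \<open>(1 / p)\<^sup>n\<close> lies in \<open>U\<close> form an open set \<open>K n\<close>.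
  These sets grow with \<open>n\<close> and exhaust \<open>U\<close>, so by compactness a single one contains \<open>U\<close>.
\<close>

lemma compact_open_uniform_radius:
  assumes "compact_open v Qp U"
  obtains N where "\<And>y w. y \<in> U \<Longrightarrow> w \<in> Zp v Qp \<Longrightarrow> v (w - y) \<le> (1 / real p) ^ N \<Longrightarrow> w \<in> U"
proof -
  have opn: "openin (Zp_topology v Qp) U" and cmp: "compactin (Zp_topology v Qp) U"
    using assms by (auto simp: compact_open_def)
  have UZ: "U \<subseteq> Zp v Qp"
    using openin_subset[OF opn] by (simp add: Zp_topology_def)
  define K where "K n = {y \<in> Zp v Qp. {w \<in> Zp v Qp. v (w - y) \<le> (1 / real p) ^ n} \<subseteq> U}" for n
  have "openin (Zp_topology v Qp) (K n)" for n
  proof (rule openin_Zp_if_uniform_balls[of _ n])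
    fix w y
    assume "w \<in> K n" and y: "y \<in> Zp v Qp" and yw: "v (y - w) \<le> (1 / real p) ^ n"
    then show "y \<in> K n"
      using v_ultrametric[OF _ yw] by (auto simp: K_def)
  qed (auto simp: K_def)
  moreover have "U \<subseteq> \<Union> (range K)"
  proof
    fix y assume y: "y \<in> U"
    then obtain n where "{w \<in> Zp v Qp. v (w - y) \<le> (1 / real p) ^ n} \<subseteq> U"
      using UZ opn open_contains_ball_of_radius_power by blast
    then show "y \<in> \<Union> (range K)"
      using y UZ by (auto simp: K_def)
  qed
  ultimately obtain F where F: "finite F" "F \<subseteq> range K" "U \<subseteq> \<Union> F"
    using compactinD[OF cmp, of "range K"] by auto
  obtain I where I: "finite I" "F = K ` I"
    using finite_subset_image[OF F(1,2)] by auto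
  obtain N where N: "\<forall>i\<in>I. i \<le> N"
    using I(1) finite_nat_set_iff_bounded_le by blast
  show thesis
  proof (rule that)
    fix y w assume y: "y \<in> U" and w: "w \<in> Zp v Qp" "v (w - y) \<le> (1 / real p) ^ N"
    obtain i where i: "i \<in> I" "y \<in> K i"
      using y F(3) I(2) by auto
    have "(1 / real p) ^ N \<le> (1 / real p) ^ i"
      using N i(1) one_less_p by (intro power_decreasing) auto
    then show "w \<in> U"
      using i(2) w by (auto simp: K_def)
  qed
qed

text \<open>
  With a radius \<open>(1 / p)\<^sup>N\<close> that works for all points of \<open>U\<close>, a coset modulo \<open>p\<^sup>N\<close> that meets
  \<open>U\<close> is contained in \<open>U\<close>.
\<close>

lemma compact_open_decomposition:
  assumes "compact_open v Qp U"
  obtains N A where "A \<subseteq> {..<p ^ N}" and "U = (\<Union>a\<in>A. coset_Zp p v Qp a N)"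
proof -
  obtain N where N: "\<And>y w. y \<in> U \<Longrightarrow> w \<in> Zp v Qp \<Longrightarrow> v (w - y) \<le> (1 / real p) ^ N \<Longrightarrow> w \<in> U"
    using compact_open_uniform_radius[OF assms] by blast
  have UZ: "U \<subseteq> Zp v Qp"
    using assms openin_subset by (fastforce simp: compact_open_def Zp_topology_def)
  define A where "A = {a. a < p ^ N \<and> coset_Zp p v Qp a N \<subseteq> U}"
  have "U \<subseteq> (\<Union>a\<in>A. coset_Zp p v Qp a N)"
  proof
    fix x assume x: "x \<in> U"
    then obtain a where a: "a < p ^ N" "x \<in> coset_Zp p v Qp a N"
      using UZ Zp_covered_by_cosets by blast
    have "coset_Zp p v Qp a N \<subseteq> U"
    proof
      fix w assume w: "w \<in> coset_Zp p v Qp a N"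
      have "v (w - x) \<le> (1 / real p) ^ N"
        using a(2) w
        by - (rule v_ultrametric[of w "of_nat a"], auto simp: coset_Zp_eq_ball v_commute[of _ x])
      then show "w \<in> U"
        using w N[OF x] by (auto simp: coset_Zp_eq_ball)
    qed
    then show "x \<in> (\<Union>a\<in>A. coset_Zp p v Qp a N)"
      using a by (auto simp: A_def)
  qed
  then have "U = (\<Union>a\<in>A. coset_Zp p v Qp a N)"
    by (auto simp: A_def)
  then show thesis
    by (intro that[of A N]) (auto simp: A_def)
qed

text \<open>
  Additivity may only be applied to compact open sets. The ambient set \<open>U\<close> supplies compactness
  for the cosets inside it, which are closed. The induction carries along that the partial unions
  are again compact open.
\<close>

lemma distribution_eq_sum_cosets:
  assumes "padic_distribution v Qp \<mu>"
    and U: "compact_open v Qp U" and A: "A \<subseteq> {..<p ^ N}"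
    and sub: "(\<Union>a\<in>A. coset_Zp p v Qp a N) \<subseteq> U"
  shows "\<mu> (\<Union>a\<in>A. coset_Zp p v Qp a N) = (\<Sum>a\<in>A. \<mu> (coset_Zp p v Qp a N))"
proof -
  have add: "\<mu> (V \<union> W) = \<mu> V + \<mu> W"
    if "compact_open v Qp V" "compact_open v Qp W" "V \<inter> W = {}" for V W
    using assms(1) that by (auto simp: padic_distribution_def)
  have co: "compact_open v Qp (coset_Zp p v Qp a N)" if "a \<in> A" for a
    using closed_compactin[of "Zp_topology v Qp" U "coset_Zp p v Qp a N"] U sub that
    by (auto simp: compact_open_def coset_Zp_open coset_Zp_closed)
  have co_empty: "compact_open v Qp {}"
    by (simp add: compact_open_def)
  have "\<mu> {} = 0"
    using add[OF co_empty co_empty] by simp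
  have finA: "finite A"
    using A finite_subset by blast
  have "B \<subseteq> A \<Longrightarrow> compact_open v Qp (\<Union>a\<in>B. coset_Zp p v Qp a N) \<and>
      \<mu> (\<Union>a\<in>B. coset_Zp p v Qp a N) = (\<Sum>a\<in>B. \<mu> (coset_Zp p v Qp a N))" if "finite B" for B
    using that
  proof (induction B rule: finite_induct)
    case empty
    then show ?case
      using co_empty \<open>\<mu> {} = 0\<close> by simp
  next
    case (insert b B)
    then have "coset_Zp p v Qp b N \<inter> (\<Union>a\<in>B. coset_Zp p v Qp a N) = {}"
      using A coset_Zp_disjoint[of b N] by fastforce
    then show ?case
      using insert add[OF co] co[of b]
      by (auto simp: compact_open_def compactin_Un openin_Un)
  qed
  then show ?thesis
    using finA by blast
qed

lemma distribution_determined_by_cosets: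
  assumes "padic_distribution v Qp \<mu>" and "padic_distribution v Qp \<nu>"
    and eq: "\<And>N a. a < p ^ N \<Longrightarrow> \<mu> (coset_Zp p v Qp a N) = \<nu> (coset_Zp p v Qp a N)"
    and U: "compact_open v Qp U"
  shows "\<mu> U = \<nu> U"
proof -
  obtain N A where A: "A \<subseteq> {..<p ^ N}" and UA: "U = (\<Union>a\<in>A. coset_Zp p v Qp a N)"
    by (rule compact_open_decomposition[OF U])
  have "\<mu> U = (\<Sum>a\<in>A. \<mu> (coset_Zp p v Qp a N))"
    using distribution_eq_sum_cosets[OF assms(1) U A] unfolding UA by blast
  also have "\<dots> = (\<Sum>a\<in>A. \<nu> (coset_Zp p v Qp a N))"
    using A eq by (intro sum.cong) auto
  also have "\<dots> = \<nu> U"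
    using distribution_eq_sum_cosets[OF assms(2) U A] unfolding UA by simp
  finally show ?thesis .
qed

end

theorem corollary1:
  fixes v :: "'a::field_char_0 \<Rightarrow> real" and p :: nat and Qp Qpbar :: "'a set"
    and z :: 'a and k :: nat and h :: rat
    and f g :: "ratfun poly" and \<mu> \<nu> :: "'a set \<Rightarrow> 'a"
  assumes "padic_complex v p Qp Qpbar"
    and "k \<ge> 1"
    and "extends_mu p v Qp k z f \<mu>" and "derivs_defined_at_origin f" and "shift_equation k h f"
    and "extends_mu p v Qp k z g \<nu>" and "derivs_defined_at_origin g" and "shift_equation k h g"
  shows "f = g \<and> (\<forall>U. compact_open v Qp U \<longrightarrow> \<mu> U = \<nu> U)"
proof -
  interpret padic_complex v p Qp Qpbar
    by (rule assms(1))
  have fg: "f = g"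
    using shift_equation_unique assms(5,8) by blast
  have "\<mu> (coset_Zp p v Qp a N) = \<nu> (coset_Zp p v Qp a N)" if "a < p ^ N" for a N
    using assms(3,6) that unfolding fg extends_mu_def by metis
  moreover have "padic_distribution v Qp \<mu>" "padic_distribution v Qp \<nu>"
    using assms(3,6) by (auto simp: extends_mu_def)
  ultimately show ?thesis
    using fg distribution_determined_by_cosets by blast
qed

end
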